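(* Let $a<b$ be real numbers, let $0<\alpha<1$, fix $n\in\mathbb{N}$, $n\ge 1$, and let $x\in C^n[a,b]$ be real-valued. Then for every $t\in(a,b)$, $$ {}_aD_t^{\alpha}x(t)=\frac{1}{\Gamma(1-\alpha)}(t-a)^{-\alpha}x(t)+\sum_{i=1}^{n-1}A(\alpha,i)(t-a)^{i-\alpha}x^{(i)}(t) +\sum_{p=n}^{\infty}\left[\frac{-\Gamma(p-n+1+\alpha)}{\Gamma(-\alpha)\Gamma(1+\alpha)(p-n+1)!}(t-a)^{-\alpha}x(t)+B(\alpha,p)(t-a)^{n-1-p-\alpha}V_p(t)\right], $$ where $$ A(\alpha,i)=\frac{1}{\Gamma(i+1-\alpha)}\left[1+\sum_{p=n-i}^{\infty}\frac{\Gamma(p-n+1+\alpha)}{\Gamma(\alpha-i)(p-n+i+1)!}\right],\quad i=1,\ldots,n-1, $$ $$ B(\alpha,p)=\frac{\Gamma(p-n+1+\alpha)}{\Gamma(-\alpha)\Gamma(1+\alpha)(p-n+1)!},\qquad V_p(t)=(p-n+1)\int_a^t(\tau-a)^{p-n}x(\tau)\,d\tau . $$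
   Context: For $0<\alpha<1$ and an absolutely continuous function $x$ on $[a,b]$, the left Riemann--Liouville fractional derivative of order $\alpha$ is $$ {}_aD_t^{\alpha}x(t)=\frac{1}{\Gamma(1-\alpha)}\frac{d}{dt}\int_a^t(t-\tau)^{-\alpha}x(\tau)\,d\tau . $$ $\Gamma$ denotes the Gamma function, extended to negative non-integer arguments; $x^{(i)}$ is the $i$-th derivative. For $n=1$ the sum over $i$ from $1$ to $n-1$ is empty. The infinite series is a series over $p$ whose $p$-th term is the whole bracket. *)

theory Defs
  imports "HOL-Analysis.Analysis"
begin

(* Derivatives are taken within S, so they are one-sided at the endpoints of
   an interval S = {a..b} and depend only on the values of f on S. *)
definition deriv_on :: "real set \<Rightarrow> nat \<Rightarrow> (real \<Rightarrow> real) \<Rightarrow> real \<Rightarrow> real" where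
  "deriv_on S i f = ((\<lambda>g t. vector_derivative g (at t within S)) ^^ i) f"

definition Cn_on :: "nat \<Rightarrow> real set \<Rightarrow> (real \<Rightarrow> real) \<Rightarrow> bool" where
  "Cn_on n S f \<longleftrightarrow>
     (\<forall>i<n. deriv_on S i f differentiable_on S) \<and> continuous_on S (deriv_on S n f)"

(* At \<tau> = s the kernel is 0 powr (-\<alpha>) = 0, which does not affect integrals. *)
definition RL_integrand :: "real \<Rightarrow> (real \<Rightarrow> real) \<Rightarrow> real \<Rightarrow> real \<Rightarrow> real" where
  "RL_integrand \<alpha> x s \<tau> = (s - \<tau>) powr (-\<alpha>) * x \<tau>"

definition left_RL_deriv :: "real \<Rightarrow> real \<Rightarrow> (real \<Rightarrow> real) \<Rightarrow> real \<Rightarrow> real" where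
  "left_RL_deriv a \<alpha> x t =
     1 / Gamma (1 - \<alpha>) * deriv (\<lambda>s. integral {a..s} (RL_integrand \<alpha> x s)) t"

(* The integral and its derivative in left_RL_deriv exist as Lebesgue integrals
   and as a genuine derivative, so that no default values are involved. *)
definition left_RL_differentiable :: "real \<Rightarrow> real \<Rightarrow> (real \<Rightarrow> real) \<Rightarrow> real \<Rightarrow> bool" where
  "left_RL_differentiable a \<alpha> x t \<longleftrightarrow>
     (\<forall>\<^sub>F s in nhds t. RL_integrand \<alpha> x s absolutely_integrable_on {a..s}) \<and>
     (\<lambda>s. integral {a..s} (RL_integrand \<alpha> x s)) differentiable (at t)"

(* The factorial is that of p - n + i + 1. It is written as p + i + 1 - n
   because p - n may be negative here: the terms are used for p \<ge> n - i. *)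
definition A_term :: "nat \<Rightarrow> real \<Rightarrow> nat \<Rightarrow> nat \<Rightarrow> real" where
  "A_term n \<alpha> i p =
     Gamma (real p - real n + 1 + \<alpha>) / (Gamma (\<alpha> - real i) * fact (p + i + 1 - n))"

(* Series over p \<ge> m are written as series over k = p - m. *)
definition A_coeff :: "nat \<Rightarrow> real \<Rightarrow> nat \<Rightarrow> real" where
  "A_coeff n \<alpha> i = 1 / Gamma (real i + 1 - \<alpha>) * (1 + (\<Sum>k. A_term n \<alpha> i (k + (n - i))))"

(* B_coeff and V_moment are used for p \<ge> n only, so p - n does not truncate. *)
definition B_coeff :: "nat \<Rightarrow> real \<Rightarrow> nat \<Rightarrow> real" where
  "B_coeff n \<alpha> p =
     Gamma (real p - real n + 1 + \<alpha>) / (Gamma (-\<alpha>) * Gamma (1 + \<alpha>) * fact (p - n + 1))"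

definition V_moment :: "nat \<Rightarrow> real \<Rightarrow> (real \<Rightarrow> real) \<Rightarrow> nat \<Rightarrow> real \<Rightarrow> real" where
  "V_moment n a x p t = real (p - n + 1) * integral {a..t} (\<lambda>\<tau>. (\<tau> - a) ^ (p - n) * x \<tau>)"

definition expansion_term ::
    "nat \<Rightarrow> real \<Rightarrow> real \<Rightarrow> (real \<Rightarrow> real) \<Rightarrow> real \<Rightarrow> nat \<Rightarrow> real" where
  "expansion_term n a \<alpha> x t p =
     - Gamma (real p - real n + 1 + \<alpha>) / (Gamma (-\<alpha>) * Gamma (1 + \<alpha>) * fact (p - n + 1))
         * (t - a) powr (-\<alpha>) * x t
     + B_coeff n \<alpha> p * (t - a) powr (real n - 1 - real p - \<alpha>) * V_moment n a x p t"

end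

theory Submission
  imports Defs
begin

text \<open>
  Integration by parts turns the \<open>p\<close>-th bracket into a multiple of
  \<open>\<integral> (\<tau> - a) ^ k * x' \<tau> d\<tau>\<close> with \<open>k = p - n + 1 \<ge> 1\<close>, and the
  coefficients are those of the binomial series of \<open>(1 - v) powr (-\<alpha>)\<close>. Summing under the integral therefore
  gives \<open>\<integral> (t - \<tau>) powr (-\<alpha>) * x' \<tau> d\<tau>\<close> up to boundary terms, which is the
  Riemann--Liouville derivative in its Caputo form. The value of the series does not depend on \<open>n\<close>:
  for \<open>i \<ge> 1\<close> the bracket in \<open>A(\<alpha>, i)\<close> is the binomial series of \<open>(1 - v) powr (i - \<alpha>)\<close> at
  \<open>v = 1\<close>, so all the coefficients \<open>A(\<alpha>, i)\<close> vanish.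
  All integrals are rescaled to \<open>[0, 1]\<close> by \<open>\<tau> = a + (t - a) v\<close>, so that the singularity of the
  kernel no longer moves with \<open>t\<close> when differentiating.
\<close>

section \<open>Binomial series, inside the unit disc and at its boundary\<close>

text \<open>The partial sums have the closed form \<open>(- 1) ^ n * (z - 1 gchoose n)\<close>,
  which the asymptotics of binomial coefficients show to be O(n^(-z)). This reaches the boundary
  point v = 1 of the series of (1 - v)^z, outside the range |v| < 1 of the general binomial
  theorem.\<close>

lemma gbinomial_alternating_sums_0:
  fixes z :: real
  assumes "z > 0"
  shows "(\<lambda>k. (- 1) ^ k * (z gchoose k)) sums 0"
proof -
  \<comment> \<open>The divisor is (-1)^n n^(-z), so multiplying the quotient by n^(-z) recovers the
    partial sum; a bounded factor times a null sequence tends to 0.\<close>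
  have "(\<lambda>n. (z - 1 gchoose n) / ((-1) ^ n / exp (z * ln (real n)))) \<longlonglongrightarrow> inverse (Gamma (1 - z))"
    using gbinomial_asymptotic[of "z - 1"] by simp
  moreover have "(\<lambda>n. inverse (exp (z * ln (real n)))) \<longlonglongrightarrow> 0"
  proof -
    have "filterlim (\<lambda>n. z * ln (real n)) at_top sequentially"
      using assms by (intro filterlim_tendsto_pos_mult_at_top[OF tendsto_const]
        filterlim_compose[OF ln_at_top filterlim_real_sequentially]) auto
    then show ?thesis
      by (intro tendsto_inverse_0_at_top filterlim_compose[OF exp_at_top])
  qed
  ultimately have "(\<lambda>n. (z - 1 gchoose n) / ((-1) ^ n / exp (z * ln (real n)))
      * inverse (exp (z * ln (real n)))) \<longlonglongrightarrow> inverse (Gamma (1 - z)) * 0"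
    by (rule tendsto_mult)
  moreover have "(z - 1 gchoose n) / ((-1) ^ n / exp (z * ln (real n))) * inverse (exp (z * ln (real n)))
      = (\<Sum>k\<le>n. (- 1) ^ k * (z gchoose k))" for n
    using gbinomial_sum_lower_neg[of z n]
    by (simp add: divide_inverse power_inverse[symmetric] mult.commute)
  ultimately show ?thesis
    unfolding sums_def_le by simp
qed

text \<open>This is the binomial series with exponent -\<alpha>. Writing the coefficients with
  \<open>pochhammer\<close> makes them visibly nonnegative for \<alpha> > 0, on which the later
  domination argument rests.\<close>

lemma pochhammer_over_fact_sums:
  fixes \<alpha> v :: real
  assumes "\<bar>v\<bar> < 1"
  shows "(\<lambda>k. pochhammer \<alpha> k / fact k * v ^ k) sums (1 - v) powr (-\<alpha>)"
proof -
  have "(- \<alpha> gchoose k) * (- v) ^ k = pochhammer \<alpha> k / fact k * v ^ k" for k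
    by (simp add: gbinomial_pochhammer power_minus[of v])
  then show ?thesis
    using gen_binomial_real[of "-v" "-\<alpha>"] assms by simp
qed

lemma Gamma_plus_nat_div:
  fixes z :: real
  assumes "z \<notin> \<int>\<^sub>\<le>\<^sub>0"
  shows "Gamma (z + real n) = pochhammer z n * Gamma z"
  using pochhammer_Gamma[OF assms, of n] assms Gamma_eq_zero_iff[of z] by (simp add: field_simps)

text \<open>The terms are those of the alternating binomial series with exponent i - \<alpha> > 0,
  from index 1 on. That series sums to 0 and its term of index 0 is 1, which leaves -1 and cancels
  the 1 in \<open>A_coeff\<close>.\<close>

lemma A_term_sums:
  assumes "0 < \<alpha>" "\<alpha> < 1" "i \<ge> 1" "i < n"
  shows "(\<lambda>k. A_term n \<alpha> i (k + (n - i))) sums (- 1)"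
proof -
  \<comment> \<open>An integer value would put an integer strictly between 0 and 1. Hence
    \<open>Gamma (\<alpha> - real i)\<close> is a genuine nonzero value and cancels below.\<close>
  have ni: "\<alpha> - real i \<notin> \<int>\<^sub>\<le>\<^sub>0"
  proof
    assume "\<alpha> - real i \<in> \<int>\<^sub>\<le>\<^sub>0"
    then obtain m where "\<alpha> - real i = of_int m" by (elim nonpos_Ints_cases)
    then have "\<alpha> = of_int (m + int i)" by simp
    then show False using assms(1,2)
      by (metis of_int_0_less_iff of_int_less_1_iff zless_imp_add1_zle add_0 not_less)
  qed
  have A_eq: "A_term n \<alpha> i (k + (n - i)) = (- 1) ^ Suc k * ((real i - \<alpha>) gchoose Suc k)" for k
  proof -
    have e: "real (k + (n - i)) - real n + 1 + \<alpha> = (\<alpha> - real i) + real (Suc k)"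
      using assms(4) by (simp add: of_nat_diff)
    have f: "k + (n - i) + i + 1 - n = Suc k"
      using assms(4) by simp
    have "(- 1) ^ Suc k * ((real i - \<alpha>) gchoose Suc k) = pochhammer (\<alpha> - real i) (Suc k) / fact (Suc k)"
      by (simp add: gbinomial_pochhammer power_mult_distrib[symmetric] mult.assoc[symmetric] del: fact_Suc)
    moreover have "A_term n \<alpha> i (k + (n - i)) = pochhammer (\<alpha> - real i) (Suc k) / fact (Suc k)"
      unfolding A_term_def e f Gamma_plus_nat_div[OF ni] using ni Gamma_eq_zero_iff[of "\<alpha> - real i"]
      by (simp del: fact_Suc)
    ultimately show ?thesis by simp
  qed
  have "(\<lambda>k. (- 1) ^ k * ((real i - \<alpha>) gchoose k)) sums 0"
    using assms by (intro gbinomial_alternating_sums_0) simp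
  then show ?thesis
    using sums_Suc_iff[of "\<lambda>k. (- 1) ^ k * ((real i - \<alpha>) gchoose k)" "-1"] by (simp add: A_eq)
qed

section \<open>Integrability of the singular kernel and rescaling to the unit interval\<close>

lemma absolutely_integrable_continuous_mult:
  fixes f g :: "real \<Rightarrow> real"
  assumes "f absolutely_integrable_on {a..b}" "continuous_on {a..b} g"
  shows "(\<lambda>v. f v * g v) absolutely_integrable_on {a..b}"
proof -
  have "(\<lambda>v. g v * f v) absolutely_integrable_on {a..b}"
    using assms by (intro absolutely_integrable_bounded_measurable_product_real
      compact_imp_bounded compact_continuous_image continuous_imp_measurable_on_sets_lebesgue) auto
  then show ?thesis by (simp add: mult.commute)
qed

text \<open>The antiderivative -(s - \<tau>)^(1 - \<alpha>) / (1 - \<alpha>) is continuous up to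
  \<tau> = s because \<alpha> < 1, so differentiability in the interior is enough; nonnegativity
  upgrades integrability to absolute integrability.\<close>

lemma absolutely_integrable_RL_kernel:
  fixes \<alpha> s :: real
  assumes "\<alpha> < 1" "a \<le> s"
  shows "(\<lambda>\<tau>. (s - \<tau>) powr (-\<alpha>)) absolutely_integrable_on {a..s}"
proof (rule nonnegative_absolutely_integrable_1)
  have "((\<lambda>\<tau>. (s - \<tau>) powr (-\<alpha>)) has_integral
      - ((s - s) powr (1 - \<alpha>) / (1 - \<alpha>)) - (- ((s - a) powr (1 - \<alpha>) / (1 - \<alpha>)))) {a..s}"
    using assms
    by (intro fundamental_theorem_of_calculus_interior)
       (auto intro!: continuous_intros continuous_on_powr' derivative_eq_intros
         simp flip: has_real_derivative_iff_has_vector_derivative)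
  then show "(\<lambda>\<tau>. (s - \<tau>) powr (-\<alpha>)) integrable_on {a..s}"
    by blast
qed simp

lemma integral_rescale_unit:
  fixes f :: "real \<Rightarrow> real"
  assumes "a < s"
  shows "integral {a..s} f = (s - a) * integral {0..1} (\<lambda>v. f (a + (s - a) * v))"
proof -
  have iff: "((\<lambda>v. f (a + (s - a) * v)) has_integral (I / (s - a))) {0..1} \<longleftrightarrow> (f has_integral I) {a..s}" for I
    using has_integral_affinity_iff[of "s - a" f a I a s] assms by (simp add: field_simps)
  show ?thesis
  proof (cases "f integrable_on {a..s}")
    case True
    then show ?thesis using iff[of "integral {a..s} f"] assms
      by (simp add: integrable_integral integral_unique)
  next
    \<comment> \<open>Rescaling preserves non-integrability, so both integrals take the default
      value 0.\<close>
    case False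
    have "\<not> (\<lambda>v. f (a + (s - a) * v)) integrable_on {0..1}"
    proof
      assume "(\<lambda>v. f (a + (s - a) * v)) integrable_on {0..1}"
      then obtain I where "((\<lambda>v. f (a + (s - a) * v)) has_integral I) {0..1}" by blast
      then show False using iff[of "I * (s - a)"] assms False by auto
    qed
    with False show ?thesis by (simp add: not_integrable_integral)
  qed
qed

section \<open>The moment series of the kernel\<close>

text \<open>Dominated convergence applied to the binomial series of the kernel: its coefficients are
  nonnegative, so on (0, 1) every partial sum is bounded by the full kernel, which is integrable
  against |g|.\<close>

lemma weighted_moments_sums:
  fixes g :: "real \<Rightarrow> real"
  assumes "0 < \<alpha>" "\<alpha> < 1" "continuous_on {0..1} g"
  shows "(\<lambda>k. pochhammer \<alpha> k / fact k * integral {0..1} (\<lambda>v. v ^ k * g v))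
           sums integral {0..1} (\<lambda>v. (1 - v) powr (-\<alpha>) * g v)"
proof -
  define c where "c k = pochhammer \<alpha> k / fact k" for k
  have c0: "c k \<ge> 0" for k
    using assms(1) by (simp add: c_def pochhammer_nonneg)
  let ?f = "\<lambda>m v. (\<Sum>k<m. c k * v ^ k) * g v"
  let ?w = "\<lambda>v. (1 - v) powr (-\<alpha>)"
  have csum: "(\<lambda>k. c k * v ^ k) sums ?w v" if "v \<in> {0<..<1}" for v
    unfolding c_def using that by (intro pochhammer_over_fact_sums) auto
  have fint: "?f m integrable_on {0..1}" for m
    by (intro integrable_continuous_real continuous_intros assms)
  have "(\<lambda>v. ?w v * \<bar>g v\<bar>) absolutely_integrable_on {0..1}"
    using assms by (intro absolutely_integrable_continuous_mult absolutely_integrable_RL_kernel continuous_intros) auto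
  then have hint: "(\<lambda>v. ?w v * \<bar>g v\<bar>) integrable_on {0<..<1}"
    by (simp add: absolutely_integrable_on_def integrable_on_Icc_iff_Ioo)
  \<comment> \<open>The open interval avoids v = 1, where the kernel has the conventional value 0
    and would not dominate the partial sums.\<close>
  have "(\<lambda>m. integral {0<..<1} (?f m)) \<longlonglongrightarrow> integral {0<..<1} (\<lambda>v. ?w v * g v)"
  proof (rule dominated_convergence(2)[OF _ hint])
    show "?f m integrable_on {0<..<1}" for m
      using fint by (simp add: integrable_on_Icc_iff_Ioo)
    show "norm (?f m v) \<le> ?w v * \<bar>g v\<bar>" if "v \<in> {0<..<1}" for m v
    proof -
      have "(\<Sum>k<m. c k * v ^ k) \<le> ?w v"
        using sum_le_suminf[OF sums_summable[OF csum[OF that]], of "{..<m}"] sums_unique[OF csum[OF that]] c0 that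
        by simp
      moreover have "0 \<le> (\<Sum>k<m. c k * v ^ k)"
        using c0 that by (intro sum_nonneg) simp
      ultimately show ?thesis
        by (simp add: abs_mult mult_right_mono)
    qed
    show "(\<lambda>m. ?f m v) \<longlonglongrightarrow> ?w v * g v" if "v \<in> {0<..<1}" for v
      using csum[OF that] unfolding sums_def by (intro tendsto_intros)
  qed
  then have "(\<lambda>m. integral {0..1} (?f m)) \<longlonglongrightarrow> integral {0..1} (\<lambda>v. ?w v * g v)"
    by (simp add: integral_open_interval_real)
  moreover have "integral {0..1} (?f m) = (\<Sum>k<m. c k * integral {0..1} (\<lambda>v. v ^ k * g v))" for m
  proof -
    have "integral {0..1} (?f m) = integral {0..1} (\<lambda>v. \<Sum>k<m. c k * (v ^ k * g v))"
      by (simp add: sum_distrib_right mult.assoc)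
    also have "\<dots> = (\<Sum>k<m. integral {0..1} (\<lambda>v. c k * (v ^ k * g v)))"
      by (intro integral_sum integrable_continuous_real continuous_intros assms) auto
    finally show ?thesis by simp
  qed
  ultimately show ?thesis
    by (simp add: sums_def c_def)
qed

section \<open>Integration by parts on the unit interval\<close>

lemma moment_by_parts:
  fixes y y' :: "real \<Rightarrow> real"
  assumes "\<And>v. v \<in> {0..1} \<Longrightarrow> (y has_real_derivative y' v) (at v within {0..1})"
    and "continuous_on {0..1} y'"
  shows "integral {0..1} (\<lambda>v. v ^ Suc k * y' v) = y 1 - real (Suc k) * integral {0..1} (\<lambda>v. v ^ k * y v)"
proof -
  have cy: "continuous_on {0..1} y"
    using assms(1) by (meson DERIV_continuous_on)
  \<comment> \<open>The derivative rules produce the exponent k - 1, which truncates at k = 0; there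
    the factor \<open>real k\<close> removes that term.\<close>
  have dpow: "v ^ k + real k * v ^ (k - Suc 0) * v = (1 + real k) * v ^ k" for v :: real
    by (cases k) (simp_all add: algebra_simps)
  have "((\<lambda>v. real (Suc k) * (v ^ k * y v) + v ^ Suc k * y' v) has_integral 1 ^ Suc k * y 1 - 0 ^ Suc k * y 0) {0..1}"
    by (intro fundamental_theorem_of_calculus)
       (auto intro!: derivative_eq_intros assms(1) simp: dpow simp flip: has_real_derivative_iff_has_vector_derivative)
  moreover have "integral {0..1} (\<lambda>v. real (Suc k) * (v ^ k * y v) + v ^ Suc k * y' v)
      = real (Suc k) * integral {0..1} (\<lambda>v. v ^ k * y v) + integral {0..1} (\<lambda>v. v ^ Suc k * y' v)"
    unfolding integral_mult_right[symmetric]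
    by (intro integral_add integrable_continuous_real continuous_intros cy assms)
  ultimately show ?thesis
    by (auto dest!: integral_unique)
qed

text \<open>Integrate the derivative of (1 - v)^(1 - \<alpha>) y(v): the boundary term at 1 is zero
  and the one at 0 gives y(0). The left side is what differentiating the rescaled integral produces;
  the right side is the Caputo form.\<close>

lemma RL_kernel_by_parts:
  fixes y y' :: "real \<Rightarrow> real"
  assumes "\<alpha> < 1"
    and deriv: "\<And>v. v \<in> {0..1} \<Longrightarrow> (y has_real_derivative y' v) (at v within {0..1})"
    and "continuous_on {0..1} y'"
  shows "(1 - \<alpha>) * integral {0..1} (\<lambda>v. (1 - v) powr (-\<alpha>) * y v)
      + integral {0..1} (\<lambda>v. (1 - v) powr (-\<alpha>) * (v * y' v))
    = y 0 + integral {0..1} (\<lambda>v. (1 - v) powr (-\<alpha>) * y' v)"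
proof -
  let ?w = "\<lambda>v. (1 - v) powr (-\<alpha>)"
  have cy: "continuous_on {0..1} y"
    using deriv by (meson DERIV_continuous_on)
  have int: "(\<lambda>v. ?w v * g v) integrable_on {0..1}" if "continuous_on {0..1} g" for g :: "real \<Rightarrow> real"
    using absolutely_integrable_continuous_mult[OF absolutely_integrable_RL_kernel that] assms(1)
    by (simp add: absolutely_integrable_on_def)
  have dy: "(y has_real_derivative y' v) (at v)" if "v \<in> {0<..<1}" for v
    using deriv[of v] that by (simp add: at_within_Icc_at)
  have "((\<lambda>v. ?w v * y' v - ?w v * (v * y' v) - (1 - \<alpha>) * (?w v * y v)) has_integral
      (1 - 1) powr (1 - \<alpha>) * y 1 - (1 - 0) powr (1 - \<alpha>) * y 0) {0..1}"
  proof (intro fundamental_theorem_of_calculus_interior)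
    show "continuous_on {0..1} (\<lambda>v. (1 - v) powr (1 - \<alpha>) * y v)"
      using assms(1) by (intro continuous_intros continuous_on_powr' cy) auto
    fix v :: real assume v: "v \<in> {0<..<1}"
    \<comment> \<open>Splitting off one factor 1 - v turns the y' term into the difference of the
      two integrals against the kernel.\<close>
    have pw: "(1 - v) powr (1 - \<alpha>) = (1 - v) * ?w v"
      using v by (simp add: powr_diff powr_minus divide_inverse)
    have "((\<lambda>v. (1 - v) powr (1 - \<alpha>) * y v) has_real_derivative
        (1 - v) powr (1 - \<alpha>) * y' v - (1 - \<alpha>) * (?w v * y v)) (at v)"
      using v by (auto intro!: derivative_eq_intros dy)
    also have "(1 - v) powr (1 - \<alpha>) * y' v - (1 - \<alpha>) * (?w v * y v)
        = ?w v * y' v - ?w v * (v * y' v) - (1 - \<alpha>) * (?w v * y v)"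
      unfolding pw by (simp add: algebra_simps)
    finally show "((\<lambda>v. (1 - v) powr (1 - \<alpha>) * y v) has_vector_derivative
        ?w v * y' v - ?w v * (v * y' v) - (1 - \<alpha>) * (?w v * y v)) (at v)"
      by (simp add: has_real_derivative_iff_has_vector_derivative)
  qed simp
  then have "integral {0..1} (\<lambda>v. ?w v * y' v - ?w v * (v * y' v) - (1 - \<alpha>) * (?w v * y v)) = - y 0"
    by (auto dest!: integral_unique)
  moreover have "integral {0..1} (\<lambda>v. ?w v * y' v - ?w v * (v * y' v) - (1 - \<alpha>) * (?w v * y v))
      = integral {0..1} (\<lambda>v. ?w v * y' v) - integral {0..1} (\<lambda>v. ?w v * (v * y' v))
        - (1 - \<alpha>) * integral {0..1} (\<lambda>v. ?w v * y v)"
  proof -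
    have i: "(\<lambda>v. ?w v * y' v) integrable_on {0..1}" "(\<lambda>v. ?w v * (v * y' v)) integrable_on {0..1}"
      "(\<lambda>v. (1 - \<alpha>) * (?w v * y v)) integrable_on {0..1}"
      by (intro integrable_on_mult_right int continuous_intros cy assms(3))+
    show ?thesis
      using integral_diff[OF integrable_diff[OF i(1,2)] i(3)] integral_diff[OF i(1,2)]
      by (simp only: integral_mult_right)
  qed
  ultimately show ?thesis by simp
qed

section \<open>Dilations and differentiation under the integral sign\<close>

lemma dilation_mem_Icc:
  fixes a b s v :: real
  assumes "s \<in> {a..b}" "v \<in> {0..1}"
  shows "a + (s - a) * v \<in> {a..b}"
proof -
  have "(s - a) * v \<le> (s - a) * 1" "0 \<le> (s - a) * v"
    using assms by (intro mult_left_mono mult_nonneg_nonneg; simp)+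
  then show ?thesis using assms by auto
qed

lemma continuous_on_dilation:
  fixes g :: "real \<Rightarrow> real"
  assumes "continuous_on {a..b} g" "s \<in> {a..b}"
  shows "continuous_on {0..1} (\<lambda>v. g (a + (s - a) * v))"
  using dilation_mem_Icc[OF assms(2)] by (intro continuous_on_compose2[OF assms(1)] continuous_intros) auto

lemma has_real_derivative_dilation:
  fixes x x' :: "real \<Rightarrow> real"
  assumes deriv: "\<And>\<tau>. \<tau> \<in> {a..b} \<Longrightarrow> (x has_real_derivative x' \<tau>) (at \<tau> within {a..b})"
    and s: "s \<in> {a..b}" and v: "v \<in> {0..1}"
  shows "((\<lambda>v. x (a + (s - a) * v)) has_real_derivative (s - a) * x' (a + (s - a) * v)) (at v within {0..1})"
proof -
  have "((\<lambda>v. x (a + (s - a) * v)) has_real_derivative x' (a + (s - a) * v) * (s - a)) (at v within {0..1})"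
  proof (rule DERIV_image_chain[where g = "\<lambda>v. a + (s - a) * v", unfolded o_def])
    have "(\<lambda>v. a + (s - a) * v) ` {0..1} \<subseteq> {a..b}"
      using dilation_mem_Icc[OF s] by blast
    then show "(x has_real_derivative x' (a + (s - a) * v))
        (at (a + (s - a) * v) within (\<lambda>v. a + (s - a) * v) ` {0..1})"
      by (rule DERIV_subset[OF deriv[OF dilation_mem_Icc[OF s v]]])
  qed (auto intro!: derivative_eq_intros)
  then show ?thesis by (simp only: mult.commute)
qed

text \<open>The parameter s enters only through the C^1 function x, so the difference quotients are
  dominated by |w| times a bound for |x'|, however singular the integrable weight w is.\<close>

lemma has_derivative_dilated_weighted_integral:
  fixes x x' w :: "real \<Rightarrow> real"
  assumes w: "w absolutely_integrable_on {0..1}"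
    and deriv: "\<And>\<tau>. \<tau> \<in> {a..b} \<Longrightarrow> (x has_real_derivative x' \<tau>) (at \<tau> within {a..b})"
    and cont: "continuous_on {a..b} x'"
    and t: "t \<in> {a..b}"
  shows "((\<lambda>s. integral {0..1} (\<lambda>v. w v * x (a + (s - a) * v))) has_real_derivative
      integral {0..1} (\<lambda>v. w v * (v * x' (a + (t - a) * v)))) (at t within {a..b})"
proof -
  note mem = dilation_mem_Icc[of _ a b]
  have cx: "continuous_on {a..b} x"
    using deriv by (meson DERIV_continuous_on)
  have int: "(\<lambda>v. w v * x (a + (s - a) * v)) integrable_on {0..1}" if "s \<in> {a..b}" for s
    using absolutely_integrable_continuous_mult[OF w continuous_on_dilation[OF cx that]]
    by (simp add: absolutely_integrable_on_def)
  obtain M where M: "\<And>\<tau>. \<tau> \<in> {a..b} \<Longrightarrow> \<bar>x' \<tau>\<bar> \<le> M"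
    using compact_imp_bounded[OF compact_continuous_image[OF cont compact_Icc]]
    unfolding bounded_iff by (metis image_eqI real_norm_def)
  have M0: "M \<ge> 0" using M[OF t] by linarith
  show ?thesis
    \<comment> \<open>Passing to sequences S tending to t makes dominated convergence applicable to
      the quotients \<open>?q i\<close>.\<close>
    unfolding has_field_derivative_iff tendsto_at_iff_sequentially
  proof (intro allI impI)
    fix S assume S: "\<forall>i. S i \<in> {a..b} - {t}" "S \<longlonglongrightarrow> t"
    let ?q = "\<lambda>i v. w v * ((x (a + (S i - a) * v) - x (a + (t - a) * v)) / (S i - t))"
    have qeq: "?q i v = (w v * x (a + (S i - a) * v) - w v * x (a + (t - a) * v)) / (S i - t)" for i v
      by (simp add: right_diff_distrib)
    have "(\<lambda>i. integral {0..1} (?q i)) \<longlonglongrightarrow> integral {0..1} (\<lambda>v. w v * (v * x' (a + (t - a) * v)))"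
    proof (rule dominated_convergence(2))
      show "?q i integrable_on {0..1}" for i
        unfolding qeq using S(1) t by (intro integrable_on_divide integrable_diff int) auto
      show "(\<lambda>v. \<bar>w v\<bar> * M) integrable_on {0..1}"
        using absolutely_integrable_abs[OF w] by (intro integrable_on_mult_left) (simp add: absolutely_integrable_on_def)
      fix v :: real assume v: "v \<in> {0..1}"
      show "norm (?q i v) \<le> \<bar>w v\<bar> * M" for i
      proof -
        \<comment> \<open>Mean value inequality on [a, b]; the two arguments differ by (S i - t) v
          with 0 \<le> v \<le> 1.\<close>
        have "norm (x (a + (S i - a) * v) - x (a + (t - a) * v)) \<le> M * norm ((a + (S i - a) * v) - (a + (t - a) * v))"
          using S(1) t v by (intro field_differentiable_bound[OF _ deriv] mem) (auto simp: M)
        also have "(a + (S i - a) * v) - (a + (t - a) * v) = (S i - t) * v"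
          by (simp add: algebra_simps)
        also have "M * norm ((S i - t) * v) \<le> M * \<bar>S i - t\<bar>"
          using v M0 by (intro mult_left_mono) (auto simp: abs_mult mult_left_le)
        finally have "\<bar>x (a + (S i - a) * v) - x (a + (t - a) * v)\<bar> / \<bar>S i - t\<bar> \<le> M"
          using S(1) by (auto simp: divide_le_eq)
        then have "\<bar>w v\<bar> * (\<bar>x (a + (S i - a) * v) - x (a + (t - a) * v)\<bar> / \<bar>S i - t\<bar>) \<le> \<bar>w v\<bar> * M"
          by (intro mult_left_mono) auto
        then show ?thesis by (simp add: abs_mult)
      qed
      have "((\<lambda>s. x (a + (s - a) * v)) has_real_derivative x' (a + (t - a) * v) * v) (at t within {a..b})"
      proof (rule DERIV_image_chain[where g = "\<lambda>s. a + (s - a) * v", unfolded o_def])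
        have "(\<lambda>s. a + (s - a) * v) ` {a..b} \<subseteq> {a..b}"
          using mem v by blast
        then show "(x has_real_derivative x' (a + (t - a) * v))
            (at (a + (t - a) * v) within (\<lambda>s. a + (s - a) * v) ` {a..b})"
          by (rule DERIV_subset[OF deriv[OF mem[OF t v]]])
      qed (auto intro!: derivative_eq_intros)
      then have "(\<lambda>i. (x (a + (S i - a) * v) - x (a + (t - a) * v)) / (S i - t)) \<longlonglongrightarrow> x' (a + (t - a) * v) * v"
        using S unfolding has_field_derivative_iff tendsto_at_iff_sequentially by (auto simp: o_def)
      then show "(\<lambda>i. ?q i v) \<longlonglongrightarrow> w v * (v * x' (a + (t - a) * v))"
        by (subst mult.commute[of v]) (rule tendsto_mult_left)
    qed
    moreover have "integral {0..1} (?q i) = (integral {0..1} (\<lambda>v. w v * x (a + (S i - a) * v))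
        - integral {0..1} (\<lambda>v. w v * x (a + (t - a) * v))) / (S i - t)" for i
      unfolding qeq integral_divide using S(1) t by (subst integral_diff) (auto intro!: int)
    ultimately show "((\<lambda>s. (integral {0..1} (\<lambda>v. w v * x (a + (s - a) * v))
        - integral {0..1} (\<lambda>v. w v * x (a + (t - a) * v))) / (s - t)) \<circ> S)
        \<longlonglongrightarrow> integral {0..1} (\<lambda>v. w v * (v * x' (a + (t - a) * v)))"
      by (simp only: o_def)
  qed
qed

section \<open>The Riemann-Liouville derivative of a C^1 function\<close>

text \<open>The substitution contributes one factor s - a and the homogeneous kernel contributes (s
  - a)^(-\<alpha>).\<close>

lemma RL_integral_rescaled:
  fixes x :: "real \<Rightarrow> real"
  assumes "a < s"
  shows "integral {a..s} (RL_integrand \<alpha> x s)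
    = (s - a) powr (1 - \<alpha>) * integral {0..1} (\<lambda>v. (1 - v) powr (-\<alpha>) * x (a + (s - a) * v))"
proof -
  have "integral {0..1} (\<lambda>v. RL_integrand \<alpha> x s (a + (s - a) * v))
      = integral {0..1} (\<lambda>v. (s - a) powr (-\<alpha>) * ((1 - v) powr (-\<alpha>) * x (a + (s - a) * v)))"
  proof (rule integral_cong)
    fix v :: real assume "v \<in> {0..1}"
    have "((s - a) * (1 - v)) powr (-\<alpha>) = (s - a) powr (-\<alpha>) * (1 - v) powr (-\<alpha>)"
      by (rule powr_mult)
    moreover have "s - (a + (s - a) * v) = (s - a) * (1 - v)"
      by (simp add: algebra_simps)
    ultimately show "RL_integrand \<alpha> x s (a + (s - a) * v)
        = (s - a) powr (-\<alpha>) * ((1 - v) powr (-\<alpha>) * x (a + (s - a) * v))"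
      unfolding RL_integrand_def by simp
  qed
  moreover have "(s - a) powr (1 - \<alpha>) = (s - a) * (s - a) powr (-\<alpha>)"
    using assms by (simp add: powr_diff powr_minus divide_inverse)
  ultimately show ?thesis
    using integral_rescale_unit[OF assms, of "RL_integrand \<alpha> x s"] by simp
qed

text \<open>The product rule is applied to (s - a)^(1 - \<alpha>) times the rescaled integral;
  \<open>RL_kernel_by_parts\<close> then merges the two resulting integrals into the Caputo
  form.\<close>

lemma RL_derivative_C1:
  fixes x x' :: "real \<Rightarrow> real"
  assumes "\<alpha> < 1" and t: "t \<in> {a<..<b}"
    and deriv: "\<And>\<tau>. \<tau> \<in> {a..b} \<Longrightarrow> (x has_real_derivative x' \<tau>) (at \<tau> within {a..b})"
    and cont: "continuous_on {a..b} x'"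
  shows "left_RL_differentiable a \<alpha> x t"
    and "left_RL_deriv a \<alpha> x t = (t - a) powr (-\<alpha>) / Gamma (1 - \<alpha>) *
      (x a + integral {0..1} (\<lambda>v. (1 - v) powr (-\<alpha>) * ((t - a) * x' (a + (t - a) * v))))"
proof -
  let ?w = "\<lambda>v::real. (1 - v) powr (-\<alpha>)"
  let ?y = "\<lambda>v. x (a + (t - a) * v)"
  let ?y' = "\<lambda>v. (t - a) * x' (a + (t - a) * v)"
  let ?J = "\<lambda>s. integral {0..1} (\<lambda>v. ?w v * x (a + (s - a) * v))"
  let ?D = "(t - a) powr (-\<alpha>) * (x a + integral {0..1} (\<lambda>v. ?w v * ?y' v))"
  have cx: "continuous_on {a..b} x"
    using deriv by (meson DERIV_continuous_on)
  have t': "t \<in> {a..b}"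
    using t by simp
  note dy = has_real_derivative_dilation[of a b x x' t, OF deriv t']
  have cy': "continuous_on {0..1} ?y'"
    by (intro continuous_intros continuous_on_dilation[OF cont t'])
  have "(?J has_real_derivative integral {0..1} (\<lambda>v. ?w v * (v * x' (a + (t - a) * v)))) (at t within {a..b})"
    using assms by (intro has_derivative_dilated_weighted_integral absolutely_integrable_RL_kernel) auto
  then have dJ: "(?J has_real_derivative integral {0..1} (\<lambda>v. ?w v * (v * x' (a + (t - a) * v)))) (at t)"
    using t by (simp add: at_within_Icc_at)
  have "((\<lambda>s. (s - a) powr (1 - \<alpha>) * ?J s) has_real_derivative
      (t - a) powr (1 - \<alpha>) * integral {0..1} (\<lambda>v. ?w v * (v * x' (a + (t - a) * v)))
      + (1 - \<alpha>) * (t - a) powr (-\<alpha>) * ?J t) (at t)"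
    using t by (auto intro!: derivative_eq_intros dJ)
  \<comment> \<open>The surplus factor t - a moves into the integral, where it completes x' to the
    derivative of the rescaled function.\<close>
  also have "(t - a) powr (1 - \<alpha>) * integral {0..1} (\<lambda>v. ?w v * (v * x' (a + (t - a) * v)))
      = (t - a) powr (-\<alpha>) * integral {0..1} (\<lambda>v. ?w v * (v * ?y' v))"
  proof -
    have "integral {0..1} (\<lambda>v. ?w v * (v * ?y' v))
        = integral {0..1} (\<lambda>v. (t - a) * (?w v * (v * x' (a + (t - a) * v))))"
      by (simp add: mult_ac)
    also have "\<dots> = (t - a) * integral {0..1} (\<lambda>v. ?w v * (v * x' (a + (t - a) * v)))"
      by simp
    finally show ?thesis
      using t by (simp add: powr_diff powr_minus divide_inverse)
  qed
  also have "(t - a) powr (-\<alpha>) * integral {0..1} (\<lambda>v. ?w v * (v * ?y' v))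
      + (1 - \<alpha>) * (t - a) powr (-\<alpha>) * ?J t
      = (t - a) powr (-\<alpha>) * ((1 - \<alpha>) * ?J t + integral {0..1} (\<lambda>v. ?w v * (v * ?y' v)))"
    by (simp add: algebra_simps)
  also have "(1 - \<alpha>) * ?J t + integral {0..1} (\<lambda>v. ?w v * (v * ?y' v))
      = x a + integral {0..1} (\<lambda>v. ?w v * ?y' v)"
    using RL_kernel_by_parts[OF assms(1) dy cy'] by simp
  finally have "((\<lambda>s. (s - a) powr (1 - \<alpha>) * ?J s) has_real_derivative ?D) (at t)" .
  \<comment> \<open>The rescaled formula is available only for s > a, so the derivative is
    transferred on an open interval around t.\<close>
  then have dF: "((\<lambda>s. integral {a..s} (RL_integrand \<alpha> x s)) has_real_derivative ?D) (at t)"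
    using t by (elim has_field_derivative_transform_within_open[where S = "{a<..<b}"])
      (auto simp: RL_integral_rescaled)
  have "RL_integrand \<alpha> x s absolutely_integrable_on {a..s}" if "s \<in> {a<..<b}" for s
    using that assms(1) unfolding RL_integrand_def
    by (intro absolutely_integrable_continuous_mult absolutely_integrable_RL_kernel continuous_on_subset[OF cx]) auto
  moreover have "\<forall>\<^sub>F s in nhds t. s \<in> {a<..<b}"
    using t by (intro eventually_nhds_in_open) auto
  ultimately have "\<forall>\<^sub>F s in nhds t. RL_integrand \<alpha> x s absolutely_integrable_on {a..s}"
    by (auto elim: eventually_mono)
  then show "left_RL_differentiable a \<alpha> x t"
    unfolding left_RL_differentiable_def using dF real_differentiable_def by blast
  show "left_RL_deriv a \<alpha> x t = (t - a) powr (-\<alpha>) / Gamma (1 - \<alpha>) *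
      (x a + integral {0..1} (\<lambda>v. ?w v * ?y' v))"
    unfolding left_RL_deriv_def DERIV_imp_deriv[OF dF] by simp
qed

section \<open>The brackets of the series as moments, and the expansion\<close>

text \<open>Substituting p = k + n removes n from every exponent, Gamma argument and factorial.
  After rescaling, both halves of the bracket carry (t - a)^(-\<alpha>), and what remains is the
  right side of \<open>moment_by_parts\<close>.\<close>

lemma expansion_term_eq_moment:
  fixes x x' :: "real \<Rightarrow> real"
  assumes "0 < \<alpha>" "\<alpha> < 1" and "a < t"
    and deriv: "\<And>v. v \<in> {0..1} \<Longrightarrow> ((\<lambda>v. x (a + (t - a) * v)) has_real_derivative y' v) (at v within {0..1})"
    and cont: "continuous_on {0..1} y'"
  shows "expansion_term n a \<alpha> x t (k + n) = (t - a) powr (-\<alpha>) / Gamma (1 - \<alpha>) *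
      (pochhammer \<alpha> (Suc k) / fact (Suc k) * integral {0..1} (\<lambda>v. v ^ Suc k * y' v))"
proof -
  let ?T = "t - a"
  let ?y = "\<lambda>v. x (a + (t - a) * v)"
  let ?I = "integral {0..1} (\<lambda>v. v ^ k * ?y v)"
  let ?G = "Gamma (\<alpha> + real (Suc k)) / (Gamma (-\<alpha>) * Gamma (1 + \<alpha>) * fact (Suc k))"
  have na: "\<alpha> \<notin> \<int>\<^sub>\<le>\<^sub>0" "1 - \<alpha> \<notin> \<int>\<^sub>\<le>\<^sub>0"
    using assms(1,2) by (auto elim!: nonpos_Ints_cases)
  have nm: "-\<alpha> \<notin> \<int>\<^sub>\<le>\<^sub>0"
    using na(2) plus_one_in_nonpos_Ints_imp[of "-\<alpha>"] assms(1,2)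
    by (auto elim!: nonpos_Ints_cases simp: minus_equation_iff[of \<alpha>])
  \<comment> \<open>The recurrence of Gamma gives Gamma(-\<alpha>) Gamma(1 + \<alpha>) =
    -Gamma(\<alpha>) Gamma(1 - \<alpha>), and Gamma(\<alpha>) cancels against the numerator.\<close>
  have B: "?G = - (pochhammer \<alpha> (Suc k) / fact (Suc k)) / Gamma (1 - \<alpha>)"
  proof -
    have "Gamma (1 + \<alpha>) = \<alpha> * Gamma \<alpha>" "Gamma (1 - \<alpha>) = - \<alpha> * Gamma (- \<alpha>)"
      using Gamma_plus1[OF na(1)] Gamma_plus1[OF nm] by (simp_all add: add.commute)
    moreover have "Gamma \<alpha> \<noteq> 0" "Gamma (-\<alpha>) \<noteq> 0"
      using na nm by (simp_all add: Gamma_eq_zero_iff)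
    ultimately show ?thesis
      using assms(1) unfolding Gamma_plus_nat_div[OF na(1)] by (simp add: divide_simps del: fact_Suc)
  qed
  have "integral {a..t} (\<lambda>\<tau>. (\<tau> - a) ^ k * x \<tau>) = ?T * integral {0..1} (\<lambda>v. ?T ^ k * (v ^ k * ?y v))"
    using integral_rescale_unit[OF assms(3), of "\<lambda>\<tau>. (\<tau> - a) ^ k * x \<tau>"]
    by (simp add: power_mult_distrib mult.assoc)
  then have V: "V_moment n a x (k + n) t = ?T ^ Suc k * (real (Suc k) * ?I)"
    unfolding V_moment_def by simp
  have "?T powr (real n - 1 - real (k + n) - \<alpha>) * ?T ^ Suc k = ?T powr (-\<alpha>)"
    using assms(3) by (simp del: power_Suc add: powr_realpow[symmetric] powr_add[symmetric])
  then have pw: "?T powr (real n - 1 - real (k + n) - \<alpha>) * V_moment n a x (k + n) t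
      = ?T powr (-\<alpha>) * (real (Suc k) * ?I)"
    unfolding V by (simp only: mult.assoc[symmetric])
  have args: "real (k + n) - real n + 1 + \<alpha> = \<alpha> + real (Suc k)" "k + n - n + 1 = Suc k"
    by simp_all
  have "expansion_term n a \<alpha> x t (k + n) = - ?G * ?T powr (-\<alpha>) * x t + ?G * (?T powr (-\<alpha>) * (real (Suc k) * ?I))"
    unfolding expansion_term_def B_coeff_def args mult.assoc pw by simp
  also have "\<dots> = - ?G * ?T powr (-\<alpha>) * (?y 1 - real (Suc k) * ?I)"
    by (simp add: algebra_simps)
  also have "?y 1 - real (Suc k) * ?I = integral {0..1} (\<lambda>v. v ^ Suc k * y' v)"
    using moment_by_parts[OF deriv cont] by simp
  finally show ?thesis
    unfolding B by (simp only: mult_minus_left mult_minus_right minus_divide_left[symmetric] minus_minus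
      times_divide_eq_left times_divide_eq_right divide_divide_eq_left mult_ac)
qed

theorem theorem2p3:
  fixes a b \<alpha> t :: real and n :: nat and x :: "real \<Rightarrow> real"
  assumes "a < b" and "0 < \<alpha>" and "\<alpha> < 1" and "n \<ge> 1"
    and "Cn_on n {a..b} x" and "t \<in> {a<..<b}"
  shows "left_RL_differentiable a \<alpha> x t \<and>
    (\<forall>i\<in>{1..n - 1}. summable (\<lambda>k. A_term n \<alpha> i (k + (n - i)))) \<and>
    summable (\<lambda>k. expansion_term n a \<alpha> x t (k + n)) \<and>
    left_RL_deriv a \<alpha> x t =
      1 / Gamma (1 - \<alpha>) * (t - a) powr (-\<alpha>) * x t
      + (\<Sum>i = 1..n - 1. A_coeff n \<alpha> i * (t - a) powr (real i - \<alpha>) * deriv_on {a..b} i x t)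
      + (\<Sum>k. expansion_term n a \<alpha> x t (k + n))"
proof -
  define x' where "x' = deriv_on {a..b} 1 x"
  have "x differentiable_on {a..b}"
    using assms(4,5) by (auto simp: Cn_on_def deriv_on_def dest!: spec[of _ 0])
  then have deriv: "(x has_real_derivative x' \<tau>) (at \<tau> within {a..b})" if "\<tau> \<in> {a..b}" for \<tau>
    using that vector_derivative_works[of x "at \<tau> within {a..b}"]
    by (simp add: x'_def deriv_on_def differentiable_on_def has_real_derivative_iff_has_vector_derivative)
  have cont: "continuous_on {a..b} x'"
  \<comment> \<open>For n = 1 continuity of x' is the last clause of \<open>Cn_on\<close>; for
    larger n, x' is itself differentiable.\<close>
  proof (cases "n = 1")
    case False
    then have "x' differentiable_on {a..b}"
      using assms(4,5) by (auto simp: Cn_on_def x'_def)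
    then show ?thesis by (rule differentiable_imp_continuous_on)
  qed (use assms(5) in \<open>simp add: Cn_on_def x'_def\<close>)
  let ?y = "\<lambda>v. x (a + (t - a) * v)"
  define y' where "y' v = (t - a) * x' (a + (t - a) * v)" for v
  define P where "P = (t - a) powr (-\<alpha>) / Gamma (1 - \<alpha>)"
  have t: "t \<in> {a..b}"
    using assms(6) by simp
  have dy: "(?y has_real_derivative y' v) (at v within {0..1})" if "v \<in> {0..1}" for v
    unfolding y'_def using deriv t that by (rule has_real_derivative_dilation)
  have cy': "continuous_on {0..1} y'"
    unfolding y'_def by (intro continuous_intros continuous_on_dilation[OF cont t])
  \<comment> \<open>This is the moment of order 0. The brackets start at order 1, so it is
    subtracted from the full moment series.\<close>
  have "integral {0..1} y' = x t - x a"
    using fundamental_theorem_of_calculus[of 0 1 ?y y'] dy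
    by (auto simp: has_real_derivative_iff_has_vector_derivative dest!: integral_unique)
  then have "(\<lambda>k. pochhammer \<alpha> (Suc k) / fact (Suc k) * integral {0..1} (\<lambda>v. v ^ Suc k * y' v)) sums
      (integral {0..1} (\<lambda>v. (1 - v) powr (-\<alpha>) * y' v) - (x t - x a))"
    using weighted_moments_sums[OF assms(2,3) cy'] by (subst sums_Suc_iff) simp
  from sums_mult[OF this, of P] have S: "(\<lambda>k. expansion_term n a \<alpha> x t (k + n)) sums
      (P * (integral {0..1} (\<lambda>v. (1 - v) powr (-\<alpha>) * y' v) - (x t - x a)))"
    using expansion_term_eq_moment[OF assms(2,3) _ dy cy'] assms(6) by (simp add: P_def)
  have A: "(\<lambda>k. A_term n \<alpha> i (k + (n - i))) sums (- 1)" if "i \<in> {1..n - 1}" for i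
    using that assms(4) by (intro A_term_sums assms) auto
  have "A_coeff n \<alpha> i = 0" if "i \<in> {1..n - 1}" for i
    using sums_unique[OF A[OF that]] by (simp add: A_coeff_def)
  then have "(\<Sum>i = 1..n - 1. A_coeff n \<alpha> i * (t - a) powr (real i - \<alpha>) * deriv_on {a..b} i x t) = 0"
    by (intro sum.neutral) simp
  moreover have "left_RL_deriv a \<alpha> x t = P * (x a + integral {0..1} (\<lambda>v. (1 - v) powr (-\<alpha>) * y' v))"
    unfolding P_def y'_def by (intro RL_derivative_C1(2)[OF assms(3,6) deriv cont])
  moreover have "1 / Gamma (1 - \<alpha>) * (t - a) powr (-\<alpha>) * x t = P * x t"
    by (simp add: P_def)
  \<comment> \<open>With K the kernel integral of y', the right side is P x(t) + P (K - x(t) +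
    x(a)); x(t) cancels and the Caputo form P (x(a) + K) is left.\<close>
  ultimately have "left_RL_deriv a \<alpha> x t =
      1 / Gamma (1 - \<alpha>) * (t - a) powr (-\<alpha>) * x t
      + (\<Sum>i = 1..n - 1. A_coeff n \<alpha> i * (t - a) powr (real i - \<alpha>) * deriv_on {a..b} i x t)
      + (\<Sum>k. expansion_term n a \<alpha> x t (k + n))"
    using sums_unique[OF S] by (simp add: algebra_simps)
  then show ?thesis
    using RL_derivative_C1(1)[OF assms(3,6) deriv cont] A S by (blast intro: sums_summable)
qed

end
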